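(* Let $\mu>0$, $\tau\geqslant 0$, $a\geqslant 0$, and let $P=\begin{pmatrix}p_{11}&p_{12}\\ p_{12}&p_{22}\end{pmatrix}$ be a symmetric real matrix. For $f\in\mathcal{F}_{\mu,\infty}$ on $\mathbf{R}^d$ with minimizer $x_\star$, $f_\star=f(x_\star)$, and a trajectory $X_t$, put $$\mathcal{V}_{a,P}(X_t)=a\,(f(X_t)-f_\star)+\begin{pmatrix}X_t-x_\star\\ \dot X_t\end{pmatrix}^{\top}(P\otimes I_d)\begin{pmatrix}X_t-x_\star\\ \dot X_t\end{pmatrix}.$$ The following assertions are equivalent: (i) For every dimension $d\in\mathbf{N}$, every $f\in\mathcal{F}_{\mu,\infty}$ on $\mathbf{R}^d$ and every trajectory $X_t$ generated by the Polyak damped oscillator $\ddot X_t+2\sqrt{\mu}\,\dot X_t+\nabla f(X_t)=0$, the function $\mathcal{V}_{a,P}$ is a quadratic Lyapunov function (in particular $\mathcal{V}_{a,P}(X_t)\geqslant 0$ along the trajectory) and $\frac{d}{dt}\mathcal{V}_{a,P}(X_t)\leqslant-\tau\,\mathcal{V}_{a,P}(X_t)$. (ii) There exist $\lambda_1,\lambda_2,\nu_1,\nu_2\geqslant 0$ such that $$\begin{pmatrix}-\frac{\mu}{2}(\lambda_1+\lambda_2)+\tau p_{11} & p_{11}-2\sqrt{\mu}\,p_{12}+\tau p_{12} & -p_{12}+\frac{\lambda_1}{2}\\ p_{11}-2\sqrt{\mu}\,p_{12}+\tau p_{12} & 2(p_{12}-2\sqrt{\mu}\,p_{22})+\tau p_{22}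 & -p_{22}+\frac a2\\ -p_{12}+\frac{\lambda_1}{2} & -p_{22}+\frac a2 & 0\end{pmatrix}\preccurlyeq 0,\qquad \tau a=\lambda_1-\lambda_2,$$ $$\begin{pmatrix}P&0\\0&0\end{pmatrix}+\begin{pmatrix}\frac{\mu}{2}(\nu_1+\nu_2)&0&-\frac{\nu_1}{2}\\0&0&0\\-\frac{\nu_1}{2}&0&0\end{pmatrix}\succcurlyeq 0,\qquad a=\nu_2-\nu_1 ,$$ where $\begin{pmatrix}P&0\\0&0\end{pmatrix}$ is the $3\times 3$ matrix with upper-left $2\times2$ block $P$ and zeros elsewhere.
   Context: $\mathcal{F}_{\mu,\infty}$ denotes the family of differentiable $\mu$-strongly convex functions $f:\mathbf{R}^d\to\mathbf{R}$ (no smoothness constant imposed), i.e. $f(x)\geqslant f(y)+\langle\nabla f(y),x-y\rangle+\frac{\mu}{2}\|x-y\|^2$ for all $x,y$. Trajectories of the second-order ODE are considered for arbitrary initial position and velocity. A function of the form $\mathcal{V}_{a,P}$ is called a quadratic Lyapunov function if it is nonnegative and nonincreasing along the trajectories of the flow. $M\preccurlyeq 0$ (resp. $M\succcurlyeq 0$) means that the symmetric matrix $M$ is negative (resp. positive) semidefinite; $\otimes$ is the Kronecker product. *)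

theory Defs
  imports Complex_Main "Jordan_Normal_Form.Matrix"
begin

text \<open>
  The dimension d is quantified inside one side of the equivalence, so R^d is rendered as
  \<^term>\<open>carrier_vec d :: real vec set\<close> rather than by a type indexed by the dimension. Functions on
  R^d are total functions on \<^typ>\<open>real vec\<close>, of which only the values on the carrier matter.
\<close>

definition vec_norm :: "real vec \<Rightarrow> real" where
  "vec_norm x = sqrt (x \<bullet> x)"

text \<open>Frechet differentiability of f at x, the derivative being represented by the vector g.\<close>

definition has_gradient :: "nat \<Rightarrow> (real vec \<Rightarrow> real) \<Rightarrow> real vec \<Rightarrow> real vec \<Rightarrow> bool" where
  "has_gradient d f x g \<longleftrightarrow> g \<in> carrier_vec d \<and>
     (\<forall>e>0. \<exists>r>0. \<forall>h\<in>carrier_vec d. vec_norm h < r \<longrightarrow>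
        \<bar>f (x + h) - f x - g \<bullet> h\<bar> \<le> e * vec_norm h)"

definition gradient :: "nat \<Rightarrow> (real vec \<Rightarrow> real) \<Rightarrow> real vec \<Rightarrow> real vec" where
  "gradient d f x = (THE g. has_gradient d f x g)"

definition strongly_convex_class :: "nat \<Rightarrow> real \<Rightarrow> (real vec \<Rightarrow> real) set" where
  "strongly_convex_class d \<mu> = {f.
     (\<forall>x\<in>carrier_vec d. \<exists>g. has_gradient d f x g) \<and>
     (\<forall>x\<in>carrier_vec d. \<forall>y\<in>carrier_vec d.
        f x \<ge> f y + gradient d f y \<bullet> (x - y) + \<mu> / 2 * (vec_norm (x - y))\<^sup>2)}"

definition has_vec_deriv ::
  "nat \<Rightarrow> (real \<Rightarrow> real vec) \<Rightarrow> real vec \<Rightarrow> real filter \<Rightarrow> bool" where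
  "has_vec_deriv d X D F \<longleftrightarrow> (\<forall>i<d. ((\<lambda>t. X t $ i) has_real_derivative (D $ i)) F)"

text \<open>
  X is a solution on the time interval [0, \<open>\<infinity>\<close>), with velocity V; derivatives at time 0 are
  one-sided. Neither X 0 nor V 0 is constrained.
\<close>

definition polyak_trajectory ::
  "nat \<Rightarrow> real \<Rightarrow> (real vec \<Rightarrow> real) \<Rightarrow> (real \<Rightarrow> real vec) \<Rightarrow> (real \<Rightarrow> real vec) \<Rightarrow> bool" where
  "polyak_trajectory d \<mu> f X V \<longleftrightarrow>
     (\<forall>t\<ge>0. X t \<in> carrier_vec d \<and> V t \<in> carrier_vec d \<and>
        has_vec_deriv d X (V t) (at t within {0..}) \<and>
        (\<exists>A\<in>carrier_vec d. has_vec_deriv d V A (at t within {0..}) \<and>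
           A + (2 * sqrt \<mu>) \<cdot>\<^sub>v V t + gradient d f (X t) = 0\<^sub>v d))"

definition kronecker :: "real mat \<Rightarrow> real mat \<Rightarrow> real mat" where
  "kronecker A B = mat (dim_row A * dim_row B) (dim_col A * dim_col B)
     (\<lambda>(i, j). A $$ (i div dim_row B, j div dim_col B) * B $$ (i mod dim_row B, j mod dim_col B))"

definition quad_form :: "real mat \<Rightarrow> real vec \<Rightarrow> real" where
  "quad_form M z = z \<bullet> (M *\<^sub>v z)"

definition lyapunov_fun ::
  "nat \<Rightarrow> real \<Rightarrow> real mat \<Rightarrow> (real vec \<Rightarrow> real) \<Rightarrow> real vec \<Rightarrow> real vec \<Rightarrow> real vec \<Rightarrow> real" where
  "lyapunov_fun d a P f xstar x v =
     a * (f x - f xstar) + quad_form (kronecker P (1\<^sub>m d)) ((x - xstar) @\<^sub>v v)"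

definition lyapunov_along :: "(real \<Rightarrow> real) \<Rightarrow> bool" where
  "lyapunov_along v \<longleftrightarrow> (\<forall>t\<ge>0. 0 \<le> v t) \<and> antimono_on {0..} v"

definition psd :: "real mat \<Rightarrow> bool" where
  "psd M \<longleftrightarrow> square_mat M \<and> transpose_mat M = M \<and> (\<forall>z\<in>carrier_vec (dim_row M). 0 \<le> quad_form M z)"

definition nsd :: "real mat \<Rightarrow> bool" where
  "nsd M \<longleftrightarrow> square_mat M \<and> transpose_mat M = M \<and> (\<forall>z\<in>carrier_vec (dim_row M). quad_form M z \<le> 0)"

lemma has_gradient_unique:
  assumes x: "x \<in> carrier_vec d" and g: "has_gradient d f x g" and g': "has_gradient d f x g'"
  shows "g = g'"
proof -
  have c: "g \<in> carrier_vec d" "g' \<in> carrier_vec d"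
    using g g' by (auto simp: has_gradient_def)
  define w where "w = g - g'"
  have w: "w \<in> carrier_vec d" using c by (simp add: w_def)
  have sq: "w \<bullet> w = (\<Sum>i<d. (w $ i)\<^sup>2)"
    using w by (auto simp: scalar_prod_def power2_eq_square atLeast0LessThan)
  have nn: "0 \<le> w \<bullet> w" unfolding sq by (intro sum_nonneg) auto
  have "w \<bullet> w \<le> 0"
  proof (rule ccontr)
    assume "\<not> w \<bullet> w \<le> 0"
    then have pos: "0 < vec_norm w" by (simp add: vec_norm_def)
    define e where "e = vec_norm w / 4"
    have e: "e > 0" using pos by (simp add: e_def)
    obtain r where r: "r > 0" "\<And>h. h \<in> carrier_vec d \<Longrightarrow> vec_norm h < r \<Longrightarrow>
        \<bar>f (x + h) - f x - g \<bullet> h\<bar> \<le> e * vec_norm h"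
      using g e unfolding has_gradient_def by blast
    obtain r' where r': "r' > 0" "\<And>h. h \<in> carrier_vec d \<Longrightarrow> vec_norm h < r' \<Longrightarrow>
        \<bar>f (x + h) - f x - g' \<bullet> h\<bar> \<le> e * vec_norm h"
      using g' e unfolding has_gradient_def by blast
    define s where "s = min r r' / (2 * vec_norm w)"
    have s: "s > 0" using r(1) r'(1) pos by (simp add: s_def)
    define h where "h = s \<cdot>\<^sub>v w"
    have h: "h \<in> carrier_vec d" using w by (simp add: h_def)
    have "h \<bullet> h = s\<^sup>2 * (w \<bullet> w)" using w by (simp add: h_def power2_eq_square)
    then have nh: "vec_norm h = s * vec_norm w" using s by (simp add: vec_norm_def real_sqrt_mult)
    have "vec_norm h = min r r' / 2" using pos by (simp add: nh s_def)
    then have "vec_norm h < r" "vec_norm h < r'" using r(1) r'(1) by auto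
    then have "\<bar>f (x + h) - f x - g \<bullet> h\<bar> \<le> e * vec_norm h"
      and "\<bar>f (x + h) - f x - g' \<bullet> h\<bar> \<le> e * vec_norm h" using r(2) r'(2) h by auto
    then have "g \<bullet> h - g' \<bullet> h \<le> 2 * (e * vec_norm h)" by linarith
    moreover have "g \<bullet> h - g' \<bullet> h = w \<bullet> h"
      using c h by (simp add: w_def minus_scalar_prod_distrib)
    moreover have "w \<bullet> h = s * (vec_norm w)\<^sup>2" using w nn by (simp add: h_def vec_norm_def)
    ultimately have "s * (vec_norm w)\<^sup>2 \<le> s * (vec_norm w)\<^sup>2 / 2"
      by (simp add: nh e_def power2_eq_square algebra_simps)
    moreover have "s * (vec_norm w)\<^sup>2 > 0" using s pos by simp
    ultimately show False by linarith
  qed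
  then have "(\<Sum>i<d. (w $ i)\<^sup>2) = 0" using nn sq by simp
  then have z: "\<forall>i<d. w $ i = 0" by (simp add: sum_nonneg_eq_0_iff)
  show ?thesis
  proof (rule eq_vecI)
    fix i assume "i < dim_vec g'"
    then have "i < d" using c by auto
    then show "g $ i = g' $ i" using z c by (auto simp: w_def)
  qed (use c in auto)
qed

lemma gradient_eq:
  assumes "x \<in> carrier_vec d" "has_gradient d f x g"
  shows "gradient d f x = g"
  unfolding gradient_def using assms by (blast intro: has_gradient_unique)

end

theory Submission
  imports "HOL-Analysis.Analysis" Defs
begin

text \<open>
  With \<open>y = X - x\<^sub>\<star>\<close> and \<open>F = f X - f x\<^sub>\<star>\<close>, strong convexity gives
  \<open>\<mu>/2 |y|\<^sup>2 \<le> F \<le> \<langle>\<nabla>f X, y\<rangle> - \<mu>/2 |y|\<^sup>2\<close>. Adding these inequalities with multipliers \<open>\<lambda>\<^sub>i\<close>, \<open>\<nu>\<^sub>i\<close> to the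
  two quadratic forms in \<open>(y, V, \<nabla>f X)\<close> shows that the matrix conditions suffice.

  Conversely, dimension one suffices. The vanishing corner entries of the matrices force \<open>\<lambda>\<^sub>1 = 2 p\<^sub>1\<^sub>2\<close>,
  \<open>\<lambda>\<^sub>2 = 2 p\<^sub>1\<^sub>2 - \<tau> a\<close>, \<open>\<nu>\<^sub>1 = 0\<close>, \<open>\<nu>\<^sub>2 = a\<close> and \<open>a = 2 p\<^sub>2\<^sub>2\<close>. The function \<open>\<mu>/2 y\<^sup>2\<close> yields both
  semidefiniteness conditions, and smoothed kinks \<open>\<mu>/2 y\<^sup>2 + c sqrt (y\<^sup>2 + e\<^sup>2)\<close> with \<open>c\<close> large and
  \<open>e\<close> small yield \<open>a = 2 p\<^sub>2\<^sub>2\<close> and \<open>\<lambda>\<^sub>2 \<ge> 0\<close>. Their gradients are globally Lipschitz, so a trajectory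
  exists for every initial state, and the decay inequality is read off at time 0.
\<close>

subsection \<open>Global solutions of Lipschitz ODEs\<close>

text \<open>The fundamental theorem of calculus applies on \<open>{0..t + 1}\<close>. Since t lies
  strictly below t + 1, this interval and the half-line give the same filter at t, including the
  one-sided case t = 0.\<close>

lemma integral_has_vector_derivative_atLeast:
  fixes h :: "real \<Rightarrow> 'a::banach"
  assumes "continuous_on UNIV h" "0 \<le> t"
  shows "((\<lambda>u. integral {0..u} h) has_vector_derivative h t) (at t within {0..})"
proof -
  have "((\<lambda>u. integral {0..u} h) has_vector_derivative h t) (at t within {0..t + 1})"
    by (rule integral_has_vector_derivative) (use assms continuous_on_subset in auto)
  moreover have "at t within {0..t + 1} = at t within {0..}"
    by (rule at_within_nhd[where S = "{..<t + 1}"]) (auto simp: assms)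
  ultimately show ?thesis by simp
qed

text \<open>Integrating \<open>B * exp (K * s)\<close> reproduces the exponential with the
  additional factor 1 / K. This factor bounds the Picard operator in the weighted norm and makes it
  contract for large K.\<close>

lemma norm_integral_le_exp:
  fixes h :: "real \<Rightarrow> 'a::banach"
  assumes "continuous_on UNIV h" "0 \<le> t" "0 < K" "0 \<le> B"
    and le: "\<And>s. 0 \<le> s \<Longrightarrow> norm (h s) \<le> B * exp (K * s)"
  shows "norm (integral {0..t} h) \<le> B / K * exp (K * t)"
proof -
  have int: "((\<lambda>s. B * exp (K * s)) has_integral B / K * exp (K * t) - B / K * exp (K * 0)) {0..t}"
    using assms by (intro fundamental_theorem_of_calculus)
      (auto intro!: derivative_eq_intros simp flip: has_real_derivative_iff_has_vector_derivative)
  have "norm (integral {0..t} h) \<le> integral {0..t} (\<lambda>s. B * exp (K * s))"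
    using assms int
    by (intro integral_norm_bound_integral integrable_continuous_interval)
      (auto intro: continuous_on_subset intro!: continuous_intros)
  also have "\<dots> = B / K * exp (K * t) - B / K * exp (K * 0)"
    using int by (rule integral_unique)
  also have "\<dots> \<le> B / K * exp (K * t)" using assms by simp
  finally show ?thesis .
qed

text \<open>
  The Picard operator becomes a contraction on bounded functions once solutions are weighted by
  \<open>exp (- K t)\<close> with \<open>K > L\<close>; this yields a solution on the whole half-line at once.
\<close>

lemma lipschitz_ode_solution:
  fixes G :: "'a::banach \<Rightarrow> 'a"
  assumes lip: "L-lipschitz_on UNIV G"
  obtains y where "y 0 = y0"
    "\<And>t. 0 \<le> t \<Longrightarrow> (y has_vector_derivative G (y t)) (at t within {0..})"
proof -
  \<comment> \<open>This choice gives L / K < 1, and the summand 1 keeps K positive when L =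
    0.\<close>
  define K where "K = 2 * L + 1"
  have L: "0 \<le> L" using lip by (rule lipschitz_on_nonneg)
  then have K: "0 < K" by (simp add: K_def)
  have contG: "continuous_on UNIV G" using lip by (rule lipschitz_on_continuous_on)
  have Gdiff: "norm (G x - G y) \<le> L * norm (x - y)" for x y
    using lipschitz_onD[OF lip, of x y] by (simp add: dist_norm)
  \<comment> \<open>Substituting \<open>y t = exp (K * t) *\<^sub>R z t\<close> turns the integral
    equation for y into z = T z on the half-line. The clamp \<open>max 0 t\<close> extends T z
    constantly to negative times, so that it can live among the bounded continuous functions on all
    reals.\<close>
  define h where "h z s = G (exp (K * s) *\<^sub>R z s)" for z :: "real \<Rightarrow> 'a" and s
  define T where "T z t = exp (- (K * max 0 t)) *\<^sub>R (y0 + integral {0..max 0 t} (h z))"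
    for z :: "real \<Rightarrow> 'a" and t
  have conth: "continuous_on UNIV (h z)" if "continuous_on UNIV z" for z
    unfolding h_def using that
    by (intro continuous_on_compose2[OF contG] continuous_intros) auto
  have Tcont: "continuous_on UNIV (T z)" if z: "continuous_on UNIV z" for z
  proof -
    have "continuous_on {0..} (\<lambda>u. integral {0..u} (h z))"
      using integral_has_vector_derivative_atLeast[OF conth[OF z]]
      by (auto simp: continuous_on_eq_continuous_within intro: has_vector_derivative_continuous)
    then have "continuous_on UNIV (\<lambda>t. integral {0..max 0 t} (h z))"
      by (rule continuous_on_compose2) (auto intro!: continuous_intros)
    then show ?thesis unfolding T_def by (intro continuous_intros)
  qed
  \<comment> \<open>G grows at most linearly, so for bounded Z the integrand, and hence its
    integral, is of order \<open>exp (K * t)\<close>; the weight in T cancels this growth.\<close>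
  have Tbcont: "T (apply_bcontfun Z) \<in> bcontfun" for Z :: "real \<Rightarrow>\<^sub>C 'a"
  proof -
    obtain M where M: "norm (Z s) \<le> M" for s
      using bounded_apply_bcontfun[of Z] by (auto simp: bounded_iff)
    then have M0: "0 \<le> M" using norm_ge_zero order_trans by blast
    define B where "B = norm (G 0) + L * M"
    have B: "0 \<le> B" using L M0 by (simp add: B_def)
    have "norm (h Z s) \<le> B * exp (K * s)" if "0 \<le> s" for s
    proof -
      have "norm (h Z s) \<le> norm (G 0) + norm (h Z s - G 0)"
        by (metis add.commute diff_add_cancel norm_triangle_ineq)
      also have "\<dots> \<le> norm (G 0) * exp (K * s) + L * (exp (K * s) * M)"
      proof (intro add_mono)
        show "norm (G 0) \<le> norm (G 0) * exp (K * s)"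
          using that K by (simp add: mult_le_cancel_left1)
        have "norm (h Z s - G 0) \<le> L * (exp (K * s) * norm (Z s))"
          using Gdiff[of "exp (K * s) *\<^sub>R Z s" 0] by (simp add: h_def)
        also have "\<dots> \<le> L * (exp (K * s) * M)"
          using M[of s] L by (intro mult_left_mono) auto
        finally show "norm (h Z s - G 0) \<le> L * (exp (K * s) * M)" .
      qed
      finally show ?thesis by (simp add: B_def algebra_simps)
    qed
    then have int: "norm (integral {0..t} (h Z)) \<le> B / K * exp (K * t)" if "0 \<le> t" for t
      using that K B by (intro norm_integral_le_exp conth) auto
    have "norm (T Z t) \<le> norm y0 + B / K" for t
    proof -
      define u where "u = max 0 t"
      have u: "0 \<le> u" by (simp add: u_def)
      have "norm (T Z t) \<le> exp (- (K * u)) * (norm y0 + B / K * exp (K * u))"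
        unfolding T_def u_def[symmetric] using int[OF u]
        by (auto intro!: mult_left_mono norm_triangle_le add_left_mono)
      also have "\<dots> = exp (- (K * u)) * norm y0 + B / K"
        by (simp add: exp_minus field_simps)
      also have "\<dots> \<le> norm y0 + B / K"
        using u K by (simp add: mult_left_le_one_le)
      finally show ?thesis .
    qed
    then show ?thesis using Tcont by (auto simp: bcontfun_def bounded_iff)
  qed
  define \<Phi> where "\<Phi> Z = Bcontfun (T (apply_bcontfun Z))" for Z
  have \<Phi>: "apply_bcontfun (\<Phi> Z) = T (apply_bcontfun Z)" for Z
    using Tbcont by (simp add: \<Phi>_def Bcontfun_inverse)
  have contr: "dist (\<Phi> Z) (\<Phi> W) \<le> L / K * dist Z W" for Z W
  proof (rule dist_bound)
    fix t :: real
    define u where "u = max 0 t"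
    have u: "0 \<le> u" by (simp add: u_def)
    have intg: "h (apply_bcontfun Y) integrable_on {0..u}" for Y
      by (intro integrable_continuous_interval continuous_on_subset[OF conth]) auto
    have "norm (h Z s - h W s) \<le> L * dist Z W * exp (K * s)" for s
    proof -
      have "norm (h Z s - h W s) \<le> L * (exp (K * s) * norm (Z s - W s))"
        using Gdiff[of "exp (K * s) *\<^sub>R Z s" "exp (K * s) *\<^sub>R W s"]
        by (simp add: h_def flip: scaleR_diff_right)
      also have "\<dots> \<le> L * (exp (K * s) * dist Z W)"
        using dist_bounded[of Z s W] L by (intro mult_left_mono) (auto simp: dist_norm)
      finally show ?thesis by (simp add: algebra_simps)
    qed
    then have "norm (integral {0..u} (\<lambda>s. h Z s - h W s)) \<le> L * dist Z W / K * exp (K * u)"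
      using K L u by (intro norm_integral_le_exp continuous_intros conth) auto
    then have le: "norm (integral {0..u} (h Z) - integral {0..u} (h W)) \<le> L * dist Z W / K * exp (K * u)"
      using intg by (simp add: integral_diff)
    have "dist (\<Phi> Z t) (\<Phi> W t) = exp (- (K * u)) * norm (integral {0..u} (h Z) - integral {0..u} (h W))"
      unfolding \<Phi> T_def u_def[symmetric] dist_norm
      by (simp flip: scaleR_diff_right)
    also have "\<dots> \<le> exp (- (K * u)) * (L * dist Z W / K * exp (K * u))"
      using le by (intro mult_left_mono) auto
    also have "\<dots> = L / K * dist Z W" by (simp add: exp_minus field_simps)
    finally show "dist (\<Phi> Z t) (\<Phi> W t) \<le> L / K * dist Z W" .
  qed
  have "0 \<le> L / K" "L / K < 1" using L by (auto simp: K_def)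
  then obtain Z where "\<Phi> Z = Z" using banach_fix_type[of "L / K" \<Phi>] contr by blast
  then have Z: "apply_bcontfun Z = T (apply_bcontfun Z)" by (metis \<Phi>)
  \<comment> \<open>Undoing the weight turns the fixed point into a solution of the integral
    equation.\<close>
  define y where "y t = exp (K * t) *\<^sub>R Z t" for t
  have hy: "h Z s = G (y s)" for s by (simp add: h_def y_def)
  have y: "y t = y0 + integral {0..t} (h Z)" if "0 \<le> t" for t
    using that fun_cong[OF Z, of t] by (simp add: y_def T_def exp_minus)
  show ?thesis
  proof
    show "y 0 = y0" using y[of 0] by simp
    fix t :: real assume t: "0 \<le> t"
    have "((\<lambda>u. y0 + integral {0..u} (h Z)) has_vector_derivative 0 + h Z t) (at t within {0..})"
      using t by (intro has_vector_derivative_add integral_has_vector_derivative_atLeast conth) auto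
    then show "(y has_vector_derivative G (y t)) (at t within {0..})"
      using t y unfolding hy by (auto elim!: has_vector_derivative_transform[rotated -1])
  qed
qed

subsection \<open>Quadratic forms\<close>

no_notation inner (infix "\<bullet>" 70)
no_notation vec_nth (infixl "$" 90)

lemma scalar_prod_sum: "y \<in> carrier_vec d \<Longrightarrow> x \<bullet> y = (\<Sum>i<d. x $ i * y $ i)"
  by (auto simp: scalar_prod_def atLeast0LessThan)

lemma vec_norm_sum: "x \<in> carrier_vec d \<Longrightarrow> vec_norm x = sqrt (\<Sum>i<d. (x $ i)\<^sup>2)"
  by (simp add: vec_norm_def scalar_prod_sum power2_eq_square)

lemma vec_norm_nonneg: "0 \<le> vec_norm x"
  by (simp add: vec_norm_def scalar_prod_def sum_nonneg)

lemma vec_norm_power2: "(vec_norm x)\<^sup>2 = x \<bullet> x"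
  by (simp add: vec_norm_def scalar_prod_def sum_nonneg)

lemma mat3_dim:
  "dim_row (mat_of_rows_list 3 [r1, r2, r3]) = 3" "dim_col (mat_of_rows_list 3 [r1, r2, r3]) = 3"
  by (simp_all add: mat_of_rows_list_def)

lemma quad_form_mat3:
  assumes "z \<in> carrier_vec 3"
  shows "quad_form (mat_of_rows_list 3 [[m11, m12, m13], [m12, m22, m23], [m13, m23, m33]]) z =
    m11 * (z $ 0)\<^sup>2 + m22 * (z $ 1)\<^sup>2 + m33 * (z $ 2)\<^sup>2 +
    2 * (m12 * (z $ 0) * (z $ 1) + m13 * (z $ 0) * (z $ 2) + m23 * (z $ 1) * (z $ 2))"
proof -
  have "{0..<3::nat} = {0, 1, 2}" by auto
  then show ?thesis using assms
    by (simp add: quad_form_def scalar_prod_def mat_of_rows_list_def algebra_simps power2_eq_square)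
      (simp add: numeral_2_eq_2)
qed

lemma all_carrier_vec3_iff:
  "(\<forall>z\<in>carrier_vec 3. Q (z $ 0) (z $ 1) (z $ 2)) \<longleftrightarrow> (\<forall>x y z :: real. Q x y z)"
proof
  assume *: "\<forall>z\<in>carrier_vec 3. Q (z $ 0) (z $ 1) (z $ 2)"
  show "\<forall>x y z. Q x y z"
  proof (intro allI)
    fix x y z :: real
    define w where "w = vec 3 (\<lambda>i. if i = 0 then x else if i = 1 then y else z)"
    have "Q (w $ 0) (w $ 1) (w $ 2)" by (rule *[THEN bspec]) (simp add: w_def)
    moreover have "w $ 0 = x" "w $ 1 = y" "w $ 2 = z" by (simp_all add: w_def)
    ultimately show "Q x y z" by metis
  qed
next
  assume "\<forall>x y z. Q x y z"
  then show "\<forall>z\<in>carrier_vec 3. Q (z $ 0) (z $ 1) (z $ 2)" by simp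
qed

lemma mat3_symmetric:
  "transpose_mat (mat_of_rows_list 3 [[m11, m12, m13], [m12, m22, m23], [m13, m23, m33]]) =
    mat_of_rows_list 3 [[m11, m12, m13], [m12, m22, m23], [m13, m23, m33]]" (is "?L = ?R")
proof (rule eq_matI)
  fix i j :: nat
  assume "i < dim_row ?R" "j < dim_col ?R"
  then have "i \<in> {0, 1, 2}" "j \<in> {0, 1, 2}" by (auto simp: mat_of_rows_list_def)
  then show "?L $$ (i, j) = ?R $$ (i, j)" by (auto simp: mat_of_rows_list_def)
qed (simp_all add: mat_of_rows_list_def)

text \<open>The scalar inequality is what tests on one-dimensional trajectories deliver and what
  \<open>quadratic_nonpos_vec\<close> sums over coordinates.\<close>

lemma nsd_mat3_iff:
  "nsd (mat_of_rows_list 3 [[m11, m12, m13], [m12, m22, m23], [m13, m23, m33]]) \<longleftrightarrow>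
    (\<forall>x y z. m11 * x\<^sup>2 + m22 * y\<^sup>2 + m33 * z\<^sup>2 + 2 * (m12 * x * y + m13 * x * z + m23 * y * z) \<le> 0)"
  unfolding nsd_def mat3_symmetric all_carrier_vec3_iff[symmetric]
  by (simp add: quad_form_mat3 mat3_dim cong: ball_cong)

lemma psd_mat3_iff:
  "psd (mat_of_rows_list 3 [[m11, m12, m13], [m12, m22, m23], [m13, m23, m33]]) \<longleftrightarrow>
    (\<forall>x y z. 0 \<le> m11 * x\<^sup>2 + m22 * y\<^sup>2 + m33 * z\<^sup>2 + 2 * (m12 * x * y + m13 * x * z + m23 * y * z))"
  unfolding psd_def mat3_symmetric all_carrier_vec3_iff[symmetric]
  by (simp add: quad_form_mat3 mat3_dim cong: ball_cong)

lemma block_mat3: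
  "four_block_mat (mat_of_rows_list 2 [[p11, p12], [p12, p22]]) (0\<^sub>m 2 1) (0\<^sub>m 1 2) (0\<^sub>m 1 1) +
    mat_of_rows_list 3 [[q11, q12, q13], [q12, q22, q23], [q13, q23, q33]] =
    mat_of_rows_list 3 [[p11 + q11, p12 + q12, q13], [p12 + q12, p22 + q22, q23], [q13, q23, q33 :: real]]" (is "?L = ?R")
proof (rule eq_matI)
  fix i j :: nat
  assume "i < dim_row ?R" "j < dim_col ?R"
  then have "i \<in> {0, 1, 2}" "j \<in> {0, 1, 2}" by (auto simp: mat_of_rows_list_def)
  then show "?L $$ (i, j) = ?R $$ (i, j)" by (auto simp: mat_of_rows_list_def)
qed (simp_all add: mat_of_rows_list_def)

text \<open>Apply the scalar inequality in each coordinate and sum: a semidefinite 3 by 3 matrix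
  stays semidefinite after the Kronecker product with the identity. This is why the criterion does
  not depend on the dimension.\<close>

lemma quadratic_nonneg_vec:
  fixes m11 m22 m33 m12 m13 m23 :: real
  assumes "\<forall>x y z. 0 \<le> m11 * x\<^sup>2 + m22 * y\<^sup>2 + m33 * z\<^sup>2 + 2 * (m12 * x * y + m13 * x * z + m23 * y * z)"
    and "x \<in> carrier_vec d" "y \<in> carrier_vec d" "z \<in> carrier_vec d"
  shows "0 \<le> m11 * (x \<bullet> x) + m22 * (y \<bullet> y) + m33 * (z \<bullet> z) +
    2 * (m12 * (x \<bullet> y) + m13 * (x \<bullet> z) + m23 * (y \<bullet> z))"
proof -
  have "0 \<le> (\<Sum>i<d. m11 * (x $ i)\<^sup>2 + m22 * (y $ i)\<^sup>2 + m33 * (z $ i)\<^sup>2 +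
      2 * (m12 * (x $ i) * (y $ i) + m13 * (x $ i) * (z $ i) + m23 * (y $ i) * (z $ i)))"
    by (intro sum_nonneg) (use assms(1) in blast)
  also have "\<dots> = m11 * (x \<bullet> x) + m22 * (y \<bullet> y) + m33 * (z \<bullet> z) +
      2 * (m12 * (x \<bullet> y) + m13 * (x \<bullet> z) + m23 * (y \<bullet> z))"
    unfolding scalar_prod_sum[OF assms(2)] scalar_prod_sum[OF assms(3)] scalar_prod_sum[OF assms(4)]
      sum_distrib_left sum.distrib[symmetric]
    by (intro sum.cong refl) (simp add: power2_eq_square mult.assoc)
  finally show ?thesis .
qed

lemma quadratic_nonpos_vec:
  fixes m11 m22 m33 m12 m13 m23 :: real
  assumes "\<forall>x y z. m11 * x\<^sup>2 + m22 * y\<^sup>2 + m33 * z\<^sup>2 + 2 * (m12 * x * y + m13 * x * z + m23 * y * z) \<le> 0"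
    and "x \<in> carrier_vec d" "y \<in> carrier_vec d" "z \<in> carrier_vec d"
  shows "m11 * (x \<bullet> x) + m22 * (y \<bullet> y) + m33 * (z \<bullet> z) +
    2 * (m12 * (x \<bullet> y) + m13 * (x \<bullet> z) + m23 * (y \<bullet> z)) \<le> 0"
proof -
  have "0 \<le> (- m11) * x\<^sup>2 + (- m22) * y\<^sup>2 + (- m33) * z\<^sup>2 +
      2 * ((- m12) * x * y + (- m13) * x * z + (- m23) * y * z)" for x y z
    using assms(1)[rule_format, of x y z] by (simp add: algebra_simps)
  then show ?thesis
    using quadratic_nonneg_vec[of "- m11" "- m22" "- m33" "- m12" "- m13" "- m23" x d y z] assms(2-)
    by (simp add: algebra_simps)
qed

section \<open>The Kronecker form of the Lyapunov function in terms of inner products\<close>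

lemma kronecker_one_mat:
  assumes P: "P = mat_of_rows_list 2 [[p11, p12], [p12, p22]]"
  shows "kronecker P (1\<^sub>m d) =
    four_block_mat (p11 \<cdot>\<^sub>m 1\<^sub>m d) (p12 \<cdot>\<^sub>m 1\<^sub>m d) (p12 \<cdot>\<^sub>m 1\<^sub>m d) (p22 \<cdot>\<^sub>m 1\<^sub>m d)" (is "?K = ?B")
proof (rule eq_matI)
  have dim: "dim_row P = 2" "dim_col P = 2" by (simp_all add: P mat_of_rows_list_def)
  have entries: "P $$ (0, 0) = p11" "P $$ (0, Suc 0) = p12" "P $$ (Suc 0, 0) = p12" "P $$ (Suc 0, Suc 0) = p22"
    by (simp_all add: P mat_of_rows_list_def)
  \<comment> \<open>For an index below 2 d the quotient by d selects the block and the remainder the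
    position inside it; this is the lower (or right) block.\<close>
  have hi: "k div d = Suc 0 \<and> k mod d = k - d" if "\<not> k < d" "k < d + d" for k
    using that by (auto simp: mod_if div_if)
  show "dim_row ?K = dim_row ?B" "dim_col ?K = dim_col ?B" by (simp_all add: kronecker_def dim)
  fix i j assume "i < dim_row ?B" "j < dim_col ?B"
  then have ij: "i < d + d" "j < d + d" by auto
  then have K: "?K $$ (i, j) = P $$ (i div d, j div d) * 1\<^sub>m d $$ (i mod d, j mod d)"
    by (simp add: kronecker_def dim)
  show "?K $$ (i, j) = ?B $$ (i, j)"
    unfolding K using ij hi[OF _ ij(1)] hi[OF _ ij(2)]
    by (cases "i < d"; cases "j < d") (simp_all add: entries)
qed

lemma lyapunov_fun_eq:
  assumes P: "P = mat_of_rows_list 2 [[p11, p12], [p12, p22]]"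
    and c: "x \<in> carrier_vec d" "xstar \<in> carrier_vec d" "v \<in> carrier_vec d"
  shows "lyapunov_fun d a P f xstar x v = a * (f x - f xstar) +
    (p11 * ((x - xstar) \<bullet> (x - xstar)) + 2 * p12 * ((x - xstar) \<bullet> v) + p22 * (v \<bullet> v))"
proof -
  define y where "y = x - xstar"
  have y: "y \<in> carrier_vec d" using c by (simp add: y_def)
  have smult: "(k \<cdot>\<^sub>m 1\<^sub>m d) *\<^sub>v w = k \<cdot>\<^sub>v w" if w: "w \<in> carrier_vec d" for k :: real and w
  proof (rule eq_vecI)
    fix i assume "i < dim_vec (k \<cdot>\<^sub>v w)"
    then have i: "i < d" using w by simp
    have "row (k \<cdot>\<^sub>m 1\<^sub>m d) i = k \<cdot>\<^sub>v unit_vec d i"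
      using i by (intro eq_vecI) (auto simp: unit_vec_def)
    then show "((k \<cdot>\<^sub>m 1\<^sub>m d) *\<^sub>v w) $ i = (k \<cdot>\<^sub>v w) $ i"
      using i w by simp
  qed (use w in simp)
  have "kronecker P (1\<^sub>m d) *\<^sub>v (y @\<^sub>v v) = (p11 \<cdot>\<^sub>v y + p12 \<cdot>\<^sub>v v) @\<^sub>v (p12 \<cdot>\<^sub>v y + p22 \<cdot>\<^sub>v v)"
    unfolding kronecker_one_mat[OF P]
    by (subst four_block_mat_mult_vec[where ?nr1.0 = d and ?nc1.0 = d and ?nr2.0 = d and ?nc2.0 = d])
      (use y c in \<open>auto simp: smult\<close>)
  then have "quad_form (kronecker P (1\<^sub>m d)) (y @\<^sub>v v) =
      y \<bullet> (p11 \<cdot>\<^sub>v y + p12 \<cdot>\<^sub>v v) + v \<bullet> (p12 \<cdot>\<^sub>v y + p22 \<cdot>\<^sub>v v)"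
    unfolding quad_form_def
    by (simp only:) (rule scalar_prod_append[where ?n1.0 = d and ?n2.0 = d]; use y c in auto)
  also have "\<dots> = p11 * (y \<bullet> y) + 2 * p12 * (y \<bullet> v) + p22 * (v \<bullet> v)"
    using y c comm_scalar_prod[of v d y] by (simp add: scalar_prod_add_distrib[where n = d])
  finally show ?thesis by (simp add: lyapunov_fun_def y_def)
qed

subsection \<open>The Lyapunov function along trajectories\<close>

lemma has_vec_deriv_scalar_prod:
  assumes X: "has_vec_deriv d X D (at t within S)" and Y: "has_vec_deriv d Y E (at t within S)"
    and c: "\<And>s. s \<in> S \<Longrightarrow> X s \<in> carrier_vec d" "\<And>s. s \<in> S \<Longrightarrow> Y s \<in> carrier_vec d"
      "t \<in> S" "D \<in> carrier_vec d" "E \<in> carrier_vec d"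
  shows "((\<lambda>s. X s \<bullet> Y s) has_real_derivative D \<bullet> Y t + X t \<bullet> E) (at t within S)"
proof -
  have "((\<lambda>s. \<Sum>i<d. X s $ i * Y s $ i) has_real_derivative
      (\<Sum>i<d. D $ i * Y t $ i + E $ i * X t $ i)) (at t within S)"
    using X Y by (intro DERIV_sum DERIV_mult) (auto simp: has_vec_deriv_def)
  moreover have "(\<Sum>i<d. D $ i * Y t $ i + E $ i * X t $ i) = D \<bullet> Y t + X t \<bullet> E"
    using c by (simp add: scalar_prod_sum[where d = d] sum.distrib mult.commute)
  ultimately show ?thesis
    using c by (auto intro: has_field_derivative_transform_within[where d = 1]
        simp: scalar_prod_sum[where d = d])
qed

lemma has_vec_deriv_diff_const:
  assumes "has_vec_deriv d X D F" "c \<in> carrier_vec d"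
  shows "has_vec_deriv d (\<lambda>s. X s - c) D F"
  using assms by (auto simp: has_vec_deriv_def intro!: derivative_eq_intros)

text \<open>Chain rule. The increment of f along X splits into \<open>g \<bullet> h s\<close> and a
  remainder \<open>R s\<close>; divided by s - t, the first tends to \<open>g \<bullet> D\<close>
  coordinatewise, and the second to 0 because the difference quotients of X stay bounded.\<close>

lemma has_gradient_compose:
  assumes grad: "has_gradient d f (X t) g" and X: "has_vec_deriv d X D (at t within S)"
    and c: "\<And>s. s \<in> S \<Longrightarrow> X s \<in> carrier_vec d" "t \<in> S" "D \<in> carrier_vec d"
  shows "((\<lambda>s. f (X s)) has_real_derivative g \<bullet> D) (at t within S)"
proof -
  let ?F = "at t within S"
  define h where "h s = X s - X t" for s
  define R where "R s = f (X s) - f (X t) - g \<bullet> h s" for s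
  have g: "g \<in> carrier_vec d" using grad by (simp add: has_gradient_def)
  have h: "h s \<in> carrier_vec d" if "s \<in> S" for s using that c by (simp add: h_def)
  have quot: "((\<lambda>s. h s $ i / (s - t)) \<longlongrightarrow> D $ i) ?F" if "i < d" for i
  proof -
    have "((\<lambda>s. (X s $ i - X t $ i) / (s - t)) \<longlongrightarrow> D $ i) ?F"
      using X that by (simp add: has_vec_deriv_def has_field_derivative_iff)
    moreover have "dim_vec (X t) = d" using c by auto
    ultimately show ?thesis using that by (simp add: h_def)
  qed
  have inS: "\<forall>\<^sub>F s in ?F. s \<in> S \<and> s \<noteq> t" by (auto simp: eventually_at_filter)
  have lin: "((\<lambda>s. (g \<bullet> h s) / (s - t)) \<longlongrightarrow> g \<bullet> D) ?F"
  proof (rule Lim_transform_eventually)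
    show "((\<lambda>s. \<Sum>i<d. g $ i * (h s $ i / (s - t))) \<longlongrightarrow> g \<bullet> D) ?F"
      unfolding scalar_prod_sum[OF c(3)] by (intro tendsto_intros quot) auto
    show "\<forall>\<^sub>F s in ?F. (\<Sum>i<d. g $ i * (h s $ i / (s - t))) = (g \<bullet> h s) / (s - t)"
      using inS by eventually_elim (simp add: scalar_prod_sum[OF h] sum_divide_distrib)
  qed
  have norm: "((\<lambda>s. vec_norm (h s) / \<bar>s - t\<bar>) \<longlongrightarrow> vec_norm D) ?F"
  proof (rule Lim_transform_eventually)
    show "((\<lambda>s. sqrt (\<Sum>i<d. (h s $ i / (s - t))\<^sup>2)) \<longlongrightarrow> vec_norm D) ?F"
      unfolding vec_norm_sum[OF c(3)] by (intro tendsto_intros quot) auto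
    show "\<forall>\<^sub>F s in ?F. sqrt (\<Sum>i<d. (h s $ i / (s - t))\<^sup>2) = vec_norm (h s) / \<bar>s - t\<bar>"
      using inS
    proof eventually_elim
      case (elim s)
      then have "sqrt (\<Sum>i<d. (h s $ i / (s - t))\<^sup>2) = sqrt ((\<Sum>i<d. (h s $ i)\<^sup>2) / (s - t)\<^sup>2)"
        by (simp add: power_divide sum_divide_distrib)
      then show ?case using elim by (simp add: vec_norm_sum[OF h] real_sqrt_divide)
    qed
  qed
  have "((\<lambda>s. vec_norm (h s) / \<bar>s - t\<bar> * \<bar>s - t\<bar>) \<longlongrightarrow> vec_norm D * \<bar>t - t\<bar>) ?F"
    by (intro tendsto_intros norm)
  then have "((\<lambda>s. vec_norm (h s) / \<bar>s - t\<bar> * \<bar>s - t\<bar>) \<longlongrightarrow> 0) ?F" by simp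
  then have h0: "((\<lambda>s. vec_norm (h s)) \<longlongrightarrow> 0) ?F"
    by (rule Lim_transform_eventually) (rule eventually_mono[OF inS], auto)
  have rem: "((\<lambda>s. R s / (s - t)) \<longlongrightarrow> 0) ?F"
  proof (rule tendstoI)
    fix e :: real assume e: "0 < e"
    \<comment> \<open>N eventually bounds the difference quotients of X in norm, so the tolerance e
      / (2 N) in the definition of the gradient leaves a remainder quotient of at most e /
      2.\<close>
    define N where "N = vec_norm D + 1"
    have N: "0 < N" using vec_norm_nonneg[of D] by (simp add: N_def)
    define e' where "e' = e / (2 * N)"
    have e': "0 < e'" using e N by (simp add: e'_def)
    obtain r where r: "0 < r" "\<And>k. k \<in> carrier_vec d \<Longrightarrow> vec_norm k < r \<Longrightarrow>
        \<bar>f (X t + k) - f (X t) - g \<bullet> k\<bar> \<le> e' * vec_norm k"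
      using grad e' unfolding has_gradient_def by blast
    have "\<forall>\<^sub>F s in ?F. vec_norm (h s) < r" using order_tendstoD(2)[OF h0] r(1) by blast
    moreover have "\<forall>\<^sub>F s in ?F. vec_norm (h s) / \<bar>s - t\<bar> < N"
      using order_tendstoD(2)[OF norm] by (simp add: N_def)
    ultimately show "\<forall>\<^sub>F s in ?F. dist (R s / (s - t)) 0 < e" using inS
    proof eventually_elim
      case (elim s)
      have "dim_vec (X s) = d" "dim_vec (X t) = d" using c elim by auto
      then have "X t + h s = X s" unfolding h_def by (intro eq_vecI) auto
      then have "\<bar>R s\<bar> \<le> e' * vec_norm (h s)" using r(2)[OF h[of s]] elim by (simp add: R_def)
      then have "\<bar>R s\<bar> / \<bar>s - t\<bar> \<le> e' * (vec_norm (h s) / \<bar>s - t\<bar>)"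
        using elim by (simp add: divide_right_mono)
      also have "\<dots> \<le> e' * N" using elim e' by (intro mult_left_mono) auto
      also have "\<dots> < e" using e N by (simp add: e'_def)
      finally show ?case by (simp add: dist_real_def)
    qed
  qed
  have "((\<lambda>s. (g \<bullet> h s) / (s - t) + R s / (s - t)) \<longlongrightarrow> g \<bullet> D + 0) ?F"
    by (intro tendsto_add lin rem)
  then show ?thesis
    unfolding has_field_derivative_iff R_def by (simp flip: add_divide_distrib)
qed

section \<open>Strong convexity between a point and the minimizer\<close>

lemma carrier_vec_scalar_prod_self_eq_0:
  fixes g :: "real vec"
  assumes g: "g \<in> carrier_vec d" and "g \<bullet> g = 0"
  shows "g = 0\<^sub>v d"
proof -
  have "\<forall>i<d. g $ i = 0"
    using assms by (simp add: scalar_prod_sum[OF g] sum_nonneg_eq_0_iff)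
  then show ?thesis using g by (intro eq_vecI) auto
qed

text \<open>Along the line \<open>x + s \<cdot>\<^sub>v g\<close> the derivative of f at s = 0 is
  \<open>g \<bullet> g\<close>, and it vanishes because s = 0 is a two-sided minimum.\<close>

lemma gradient_at_arg_min:
  assumes grad: "has_gradient d f x g" and min: "is_arg_min f (\<lambda>x. x \<in> carrier_vec d) x"
  shows "g = 0\<^sub>v d"
proof -
  have x: "x \<in> carrier_vec d" and le: "\<And>y. y \<in> carrier_vec d \<Longrightarrow> f x \<le> f y"
    using min by (auto simp: is_arg_min_def not_less)
  have g: "g \<in> carrier_vec d" using grad by (simp add: has_gradient_def)
  define X where "X s = x + s \<cdot>\<^sub>v g" for s
  have X: "X s \<in> carrier_vec d" for s using x g by (simp add: X_def)
  have X0: "X 0 = x" using x g by (intro eq_vecI) (auto simp: X_def)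
  have "has_vec_deriv d X g (at 0 within UNIV)"
    using x g by (auto simp: has_vec_deriv_def X_def intro!: derivative_eq_intros)
  then have "((\<lambda>s. f (X s)) has_real_derivative g \<bullet> g) (at 0 within UNIV)"
    using grad X g by (intro has_gradient_compose) (auto simp: X0)
  then have "g \<bullet> g = 0"
    by (rule DERIV_local_min[of _ _ _ 1]) (auto simp: X0 intro: le X)
  then show ?thesis by (rule carrier_vec_scalar_prod_self_eq_0[OF g])
qed

lemma strongly_convex_class_has_gradient:
  assumes "f \<in> strongly_convex_class d \<mu>" "x \<in> carrier_vec d"
  shows "has_gradient d f x (gradient d f x)"
  using assms gradient_eq unfolding strongly_convex_class_def by fastforce

text \<open>The strong convexity inequality is used twice: based at the minimizer, where the
  gradient vanishes, it bounds the gap from below; based at x it bounds the gap from above.\<close>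

lemma strongly_convex_gap:
  assumes f: "f \<in> strongly_convex_class d \<mu>" and min: "is_arg_min f (\<lambda>x. x \<in> carrier_vec d) xstar"
    and x: "x \<in> carrier_vec d"
  defines "y \<equiv> x - xstar"
  shows "\<mu> / 2 * (y \<bullet> y) \<le> f x - f xstar"
    and "f x - f xstar \<le> y \<bullet> gradient d f x - \<mu> / 2 * (y \<bullet> y)"
proof -
  have xs: "xstar \<in> carrier_vec d" using min by (simp add: is_arg_min_def)
  have y: "y \<in> carrier_vec d" using x xs by (simp add: y_def)
  have conv: "f v \<ge> f w + gradient d f w \<bullet> (v - w) + \<mu> / 2 * ((v - w) \<bullet> (v - w))"
    if "v \<in> carrier_vec d" "w \<in> carrier_vec d" for v w
    using f that by (simp add: strongly_convex_class_def vec_norm_power2)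
  have "gradient d f xstar = 0\<^sub>v d"
    using gradient_at_arg_min[OF strongly_convex_class_has_gradient[OF f xs] min] .
  then show "\<mu> / 2 * (y \<bullet> y) \<le> f x - f xstar"
    using conv[OF x xs] y by (simp add: y_def)
  have g: "gradient d f x \<in> carrier_vec d"
    using strongly_convex_class_has_gradient[OF f x] by (simp add: has_gradient_def)
  have "xstar - x = - y" using x xs by (intro eq_vecI) (auto simp: y_def)
  then show "f x - f xstar \<le> y \<bullet> gradient d f x - \<mu> / 2 * (y \<bullet> y)"
    using conv[OF xs x] y g comm_scalar_prod[OF y g] by simp
qed

text \<open>After termwise differentiation the acceleration occurs only in inner products with y and
  v, where the differential equation eliminates it. What remains is quadratic in (y, v, g), the
  variables of the matrix inequalities.\<close>

lemma lyapunov_fun_has_real_derivative: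
  assumes P: "P = mat_of_rows_list 2 [[p11, p12], [p12, p22]]"
    and f: "f \<in> strongly_convex_class d \<mu>" and xs: "xstar \<in> carrier_vec d"
    and traj: "polyak_trajectory d \<mu> f X V" and t: "0 \<le> t"
  defines "y \<equiv> X t - xstar" and "v \<equiv> V t" and "g \<equiv> gradient d f (X t)"
  shows "((\<lambda>s. lyapunov_fun d a P f xstar (X s) (V s)) has_real_derivative
    a * (v \<bullet> g) + 2 * p11 * (y \<bullet> v) + 2 * p12 * (v \<bullet> v - 2 * sqrt \<mu> * (y \<bullet> v) - y \<bullet> g) +
    2 * p22 * (- 2 * sqrt \<mu> * (v \<bullet> v) - v \<bullet> g)) (at t within {0..})"
proof -
  have c: "X s \<in> carrier_vec d" "V s \<in> carrier_vec d" if "s \<in> {0..}" for s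
    using traj that by (auto simp: polyak_trajectory_def)
  have y: "y \<in> carrier_vec d" and v: "v \<in> carrier_vec d" using c t xs by (auto simp: y_def v_def)
  have grad: "has_gradient d f (X t) g"
    unfolding g_def using strongly_convex_class_has_gradient f c t by auto
  then have g: "g \<in> carrier_vec d" by (simp add: has_gradient_def)
  obtain A where X': "has_vec_deriv d X v (at t within {0..})" and A: "A \<in> carrier_vec d"
    and V': "has_vec_deriv d V A (at t within {0..})"
    and ode: "A + (2 * sqrt \<mu>) \<cdot>\<^sub>v v + g = 0\<^sub>v d"
    using traj t by (auto simp: polyak_trajectory_def v_def g_def)
  have wA: "w \<bullet> A = - (2 * sqrt \<mu>) * (w \<bullet> v) - w \<bullet> g" if w: "w \<in> carrier_vec d" for w
  proof -
    have "w \<bullet> (A + (2 * sqrt \<mu>) \<cdot>\<^sub>v v + g) = 0" using w ode by simp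
    moreover have "w \<bullet> (A + (2 * sqrt \<mu>) \<cdot>\<^sub>v v + g) = w \<bullet> A + 2 * sqrt \<mu> * (w \<bullet> v) + w \<bullet> g"
      using w A v g by (simp add: scalar_prod_add_distrib[where n = d])
    ultimately show ?thesis by linarith
  qed
  have Y': "has_vec_deriv d (\<lambda>s. X s - xstar) v (at t within {0..})"
    using X' xs by (rule has_vec_deriv_diff_const)
  have yc: "X s - xstar \<in> carrier_vec d" if "s \<in> {0..}" for s using c that xs by simp
  have t': "t \<in> {0..}" using t by simp
  have fX: "((\<lambda>s. f (X s)) has_real_derivative g \<bullet> v) (at t within {0..})"
    using has_gradient_compose[OF grad X' c(1) t' v] .
  have YY: "((\<lambda>s. (X s - xstar) \<bullet> (X s - xstar)) has_real_derivative v \<bullet> y + y \<bullet> v) (at t within {0..})"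
    using has_vec_deriv_scalar_prod[OF Y' Y' yc yc t' v v] by (simp add: y_def)
  have YV: "((\<lambda>s. (X s - xstar) \<bullet> V s) has_real_derivative v \<bullet> v + y \<bullet> A) (at t within {0..})"
    using has_vec_deriv_scalar_prod[OF Y' V' yc c(2) t' v A] by (simp add: y_def v_def)
  have VV: "((\<lambda>s. V s \<bullet> V s) has_real_derivative A \<bullet> v + v \<bullet> A) (at t within {0..})"
    using has_vec_deriv_scalar_prod[OF V' V' c(2) c(2) t' A A] by (simp add: v_def)
  have "((\<lambda>s. a * (f (X s) - f xstar) + (p11 * ((X s - xstar) \<bullet> (X s - xstar)) +
        2 * p12 * ((X s - xstar) \<bullet> V s) + p22 * (V s \<bullet> V s))) has_real_derivative
      a * (g \<bullet> v - 0) + (p11 * (v \<bullet> y + y \<bullet> v) + 2 * p12 * (v \<bullet> v + y \<bullet> A) + p22 * (A \<bullet> v + v \<bullet> A)))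
      (at t within {0..})"
    by (intro DERIV_add DERIV_cmult DERIV_diff DERIV_const fX YY YV VV)
  moreover have "a * (g \<bullet> v - 0) + (p11 * (v \<bullet> y + y \<bullet> v) + 2 * p12 * (v \<bullet> v + y \<bullet> A) + p22 * (A \<bullet> v + v \<bullet> A)) =
      a * (v \<bullet> g) + 2 * p11 * (y \<bullet> v) + 2 * p12 * (v \<bullet> v - 2 * sqrt \<mu> * (y \<bullet> v) - y \<bullet> g) +
      2 * p22 * (- 2 * sqrt \<mu> * (v \<bullet> v) - v \<bullet> g)"
    unfolding comm_scalar_prod[OF g v] comm_scalar_prod[OF v y] comm_scalar_prod[OF A v]
      wA[OF y] wA[OF v] by (simp add: algebra_simps)
  ultimately show ?thesis
    by (auto intro: has_field_derivative_transform_within[where d = 1]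
        simp: lyapunov_fun_eq[OF P c(1) xs c(2)] t)
qed

section \<open>From the matrix inequalities to decay along every trajectory\<close>

lemma lyapunov_along_if_decay:
  assumes "\<tau> \<ge> 0" and nonneg: "\<And>t. 0 \<le> t \<Longrightarrow> 0 \<le> v t"
    and deriv: "\<And>t. 0 \<le> t \<Longrightarrow> (v has_real_derivative D t) (at t within {0..})"
    and decay: "\<And>t. 0 \<le> t \<Longrightarrow> D t \<le> - \<tau> * v t"
  shows "lyapunov_along v"
  unfolding lyapunov_along_def monotone_on_def
proof (intro conjI allI impI ballI)
  fix s t :: real assume st: "s \<in> {0..}" "t \<in> {0..}" "s \<le> t"
  show "v t \<le> v s"
  \<comment> \<open>Only interior points need a two-sided derivative, and there the filter within
    the half-line is the full one. The endpoints, possibly 0, are covered by continuity.\<close>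
  proof (rule DERIV_nonpos_imp_decreasing_open[OF st(3)])
    fix x assume x: "s < x" "x < t"
    then have "(v has_real_derivative D x) (at x)"
      using deriv[of x] st at_within_nhd[of x "{0<..}" "{0..}" UNIV] by force
    moreover have "D x \<le> 0"
      using decay[of x] nonneg[of x] x st \<open>\<tau> \<ge> 0\<close> by (smt (verit) mult_nonneg_nonneg atLeast_iff mult_minus_left)
    ultimately show "\<exists>y. DERIV v x :> y \<and> y \<le> 0" by blast
  next
    have "continuous_on {0..} v"
      unfolding continuous_on_eq_continuous_within
      by (meson DERIV_continuous atLeast_iff deriv)
    then show "continuous_on {s..t} v" by (rule continuous_on_subset) (use st in auto)
  qed
qed (use nonneg in auto)

text \<open>
  Weighting the two interpolation inequalities between \<open>x\<close> and the minimizer by the multipliers and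
  adding them to the quadratic forms reproduces the Lyapunov function and its decay rate.
\<close>

lemma lyapunov_decay_if_multipliers:
  assumes P: "P = mat_of_rows_list 2 [[p11, p12], [p12, p22]]" and \<tau>: "0 \<le> \<tau>"
    and mult: "0 \<le> l1" "0 \<le> l2" "0 \<le> n1" "0 \<le> n2" "\<tau> * a = l1 - l2" "a = n2 - n1"
    and decay: "\<forall>x y z. (- (\<mu> / 2) * (l1 + l2) + \<tau> * p11) * x\<^sup>2 + (2 * (p12 - 2 * sqrt \<mu> * p22) + \<tau> * p22) * y\<^sup>2 +
      0 * z\<^sup>2 + 2 * ((p11 - 2 * sqrt \<mu> * p12 + \<tau> * p12) * x * y + (- p12 + l1 / 2) * x * z +
      (- p22 + a / 2) * y * z) \<le> 0"
    and nonneg: "\<forall>x y z. 0 \<le> (p11 + \<mu> / 2 * (n1 + n2)) * x\<^sup>2 + (p22 + 0) * y\<^sup>2 + 0 * z\<^sup>2 +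
      2 * ((p12 + 0) * x * y + - (n1 / 2) * x * z + 0 * y * z)"
    and f: "f \<in> strongly_convex_class d \<mu>" and min: "is_arg_min f (\<lambda>x. x \<in> carrier_vec d) xstar"
    and traj: "polyak_trajectory d \<mu> f X V"
  defines "L \<equiv> \<lambda>t. lyapunov_fun d a P f xstar (X t) (V t)"
  shows "lyapunov_along L \<and> (\<forall>t\<ge>0. \<exists>D. (L has_real_derivative D) (at t within {0..}) \<and> D \<le> - \<tau> * L t)"
proof -
  have xs: "xstar \<in> carrier_vec d" using min by (simp add: is_arg_min_def)
  define D where "D t = (let y = X t - xstar; v = V t; g = gradient d f (X t) in
    a * (v \<bullet> g) + 2 * p11 * (y \<bullet> v) + 2 * p12 * (v \<bullet> v - 2 * sqrt \<mu> * (y \<bullet> v) - y \<bullet> g) +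
    2 * p22 * (- 2 * sqrt \<mu> * (v \<bullet> v) - v \<bullet> g))" for t
  have deriv: "(L has_real_derivative D t) (at t within {0..})" if "0 \<le> t" for t
    unfolding L_def D_def Let_def using lyapunov_fun_has_real_derivative[OF P f xs traj that] .
  have bounds: "0 \<le> L t \<and> D t \<le> - \<tau> * L t" if t: "0 \<le> t" for t
  proof -
    define y v g F where "y = X t - xstar" and "v = V t" and "g = gradient d f (X t)"
      and "F = f (X t) - f xstar"
    have c: "X t \<in> carrier_vec d" "V t \<in> carrier_vec d" using traj t by (auto simp: polyak_trajectory_def)
    have yvg: "y \<in> carrier_vec d" "v \<in> carrier_vec d" "g \<in> carrier_vec d"
      using c xs strongly_convex_class_has_gradient[OF f c(1)]
      by (auto simp: y_def v_def g_def has_gradient_def)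
    have Lt: "L t = a * F + (p11 * (y \<bullet> y) + 2 * p12 * (y \<bullet> v) + p22 * (v \<bullet> v))"
      unfolding L_def using lyapunov_fun_eq[OF P c(1) xs c(2)] by (simp add: y_def v_def F_def)
    have Dt: "D t = a * (v \<bullet> g) + 2 * p11 * (y \<bullet> v) +
        2 * p12 * (v \<bullet> v - 2 * sqrt \<mu> * (y \<bullet> v) - y \<bullet> g) + 2 * p22 * (- 2 * sqrt \<mu> * (v \<bullet> v) - v \<bullet> g)"
      by (simp add: D_def Let_def y_def v_def g_def)
    define r s where "r = y \<bullet> g - \<mu> / 2 * (y \<bullet> y) - F" and "s = F - \<mu> / 2 * (y \<bullet> y)"
    have rs: "0 \<le> r" "0 \<le> s"
      using strongly_convex_gap[OF f min c(1)] by (simp_all add: r_def s_def y_def g_def F_def)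
    \<comment> \<open>The weighted slacks contribute (n2 - n1) F = a F, and their quadratic terms
      cancel those that the multipliers add to the matrix.\<close>
    have "L t = (p11 + \<mu> / 2 * (n1 + n2)) * (y \<bullet> y) + (p22 + 0) * (v \<bullet> v) + 0 * (g \<bullet> g) +
        2 * ((p12 + 0) * (y \<bullet> v) + - (n1 / 2) * (y \<bullet> g) + 0 * (v \<bullet> g)) + n1 * r + n2 * s"
      unfolding Lt r_def s_def mult(6) by (simp add: algebra_simps)
    moreover have "0 \<le> n1 * r" "0 \<le> n2 * s" using mult rs by auto
    ultimately have "0 \<le> L t" using quadratic_nonneg_vec[OF nonneg yvg] by linarith
    moreover
    \<comment> \<open>This identity holds for arbitrary l1 and l2; the condition \<tau> a = l1 - l2
      then removes the separate term in F.\<close>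
    have "D t + \<tau> * L t = (- (\<mu> / 2) * (l1 + l2) + \<tau> * p11) * (y \<bullet> y) +
        (2 * (p12 - 2 * sqrt \<mu> * p22) + \<tau> * p22) * (v \<bullet> v) + 0 * (g \<bullet> g) +
        2 * ((p11 - 2 * sqrt \<mu> * p12 + \<tau> * p12) * (y \<bullet> v) + (- p12 + l1 / 2) * (y \<bullet> g) +
        (- p22 + a / 2) * (v \<bullet> g)) + (\<tau> * a - l1 + l2) * F - l1 * r - l2 * s"
      unfolding Lt Dt r_def s_def by (simp add: algebra_simps)
    moreover have "(\<tau> * a - l1 + l2) * F = 0" using mult(5) by simp
    moreover have "0 \<le> l1 * r" "0 \<le> l2 * s" using mult rs by auto
    ultimately show ?thesis using quadratic_nonpos_vec[OF decay yvg] by simp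
  qed
  show ?thesis
    using lyapunov_along_if_decay[of \<tau> L D] deriv bounds \<tau> by blast
qed

subsection \<open>Scalar trajectories\<close>

lemma has_gradient_vec1:
  assumes "(\<phi> has_real_derivative D) (at (x $ 0))" and x: "x \<in> carrier_vec 1"
  shows "has_gradient 1 (\<lambda>z. \<phi> (z $ 0)) x (vec 1 (\<lambda>_. D))"
  unfolding has_gradient_def
proof (intro conjI allI impI)
  fix e :: real assume "0 < e"
  then obtain r where r: "0 < r"
    "\<And>y. \<bar>y - x $ 0\<bar> < r \<Longrightarrow> \<bar>\<phi> y - \<phi> (x $ 0) - D * (y - x $ 0)\<bar> \<le> e * \<bar>y - x $ 0\<bar>"
    using assms(1) unfolding has_field_derivative_def has_derivative_at_alt real_norm_def by blast
  have "\<bar>\<phi> ((x + h) $ 0) - \<phi> (x $ 0) - vec 1 (\<lambda>_. D) \<bullet> h\<bar> \<le> e * vec_norm h"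
    if h: "h \<in> carrier_vec 1" "vec_norm h < r" for h
  proof -
    have "vec_norm h = \<bar>h $ 0\<bar>" "vec 1 (\<lambda>_. D) \<bullet> h = D * h $ 0" "(x + h) $ 0 = x $ 0 + h $ 0"
      using h x by (auto simp: vec_norm_sum[where d = 1] scalar_prod_sum[where d = 1])
    then show ?thesis using r(2)[of "x $ 0 + h $ 0"] h by simp
  qed
  then show "\<exists>r>0. \<forall>h\<in>carrier_vec 1. vec_norm h < r \<longrightarrow>
      \<bar>\<phi> ((x + h) $ 0) - \<phi> (x $ 0) - vec 1 (\<lambda>_. D) \<bullet> h\<bar> \<le> e * vec_norm h"
    using r(1) by blast
qed simp

lemma strongly_convex_class_vec1:
  assumes deriv: "\<And>y. (\<phi> has_real_derivative \<phi>' y) (at y)"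
    and conv: "\<And>x y. \<phi> x \<ge> \<phi> y + \<phi>' y * (x - y) + \<mu> / 2 * (x - y)\<^sup>2"
  shows "(\<lambda>z. \<phi> (z $ 0)) \<in> strongly_convex_class 1 \<mu>"
proof -
  have grad: "gradient 1 (\<lambda>z. \<phi> (z $ 0)) x = vec 1 (\<lambda>_. \<phi>' (x $ 0))" if "x \<in> carrier_vec 1" for x
    using gradient_eq[OF that has_gradient_vec1[OF deriv that]] .
  have "\<phi> (x $ 0) \<ge> \<phi> (y $ 0) + gradient 1 (\<lambda>z. \<phi> (z $ 0)) y \<bullet> (x - y) + \<mu> / 2 * (vec_norm (x - y))\<^sup>2"
    if "x \<in> carrier_vec 1" "y \<in> carrier_vec 1" for x y
    using conv[of "y $ 0" "x $ 0"] that unfolding grad[OF that(2)] vec_norm_power2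
    by (simp add: scalar_prod_sum[where d = 1] power2_eq_square)
  then show ?thesis using has_gradient_vec1[OF deriv] unfolding strongly_convex_class_def by blast
qed

text \<open>As a first-order system in (position, velocity) the equation has a globally Lipschitz
  right-hand side, so every initial state starts a trajectory on the whole half-line.\<close>

lemma polyak_trajectory_vec1_exists:
  assumes deriv: "\<And>y. (\<phi> has_real_derivative \<phi>' y) (at y)" and lip: "L-lipschitz_on UNIV \<phi>'"
    and \<mu>: "0 \<le> \<mu>"
  obtains X V where "polyak_trajectory 1 \<mu> (\<lambda>z. \<phi> (z $ 0)) X V" "X 0 $ 0 = x0" "V 0 $ 0 = v0"
proof -
  define G where "G = (\<lambda>(x, v). (v, - (2 * sqrt \<mu>) * v - \<phi>' x))"
  define K where "K = 1 + 2 * sqrt \<mu> + L"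
  have L: "0 \<le> L" using lip by (rule lipschitz_on_nonneg)
  have "K-lipschitz_on UNIV G"
  proof (rule lipschitz_onI)
    fix p q :: "real \<times> real"
    obtain x v where p: "p = (x, v)" by (cases p)
    obtain y w where q: "q = (y, w)" by (cases q)
    have x: "\<bar>x - y\<bar> \<le> dist p q" and v: "\<bar>v - w\<bar> \<le> dist p q"
      using dist_fst_le[of p q] dist_snd_le[of p q] by (auto simp: p q dist_real_def)
    have "dist (G p) (G q) \<le> dist v w + dist (- (2 * sqrt \<mu>) * v - \<phi>' x) (- (2 * sqrt \<mu>) * w - \<phi>' y)"
      unfolding p q G_def dist_Pair_Pair prod.case
      by (rule sqrt_sum_squares_le_sum) simp_all
    also have "\<dots> \<le> \<bar>v - w\<bar> + (2 * sqrt \<mu> * \<bar>v - w\<bar> + \<bar>\<phi>' x - \<phi>' y\<bar>)"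
    proof -
      have "- (2 * sqrt \<mu>) * v - \<phi>' x - (- (2 * sqrt \<mu>) * w - \<phi>' y) =
          - (2 * sqrt \<mu> * (v - w)) - (\<phi>' x - \<phi>' y)" by (simp add: algebra_simps)
      moreover have "\<bar>2 * sqrt \<mu> * (v - w)\<bar> = 2 * sqrt \<mu> * \<bar>v - w\<bar>" using \<mu> by (simp add: abs_mult)
      ultimately show ?thesis unfolding dist_real_def by linarith
    qed
    also have "\<dots> \<le> dist p q + (2 * sqrt \<mu> * dist p q + L * dist p q)"
    proof (intro add_mono)
      show "2 * sqrt \<mu> * \<bar>v - w\<bar> \<le> 2 * sqrt \<mu> * dist p q" using v \<mu> by (intro mult_left_mono) auto
      have "\<bar>\<phi>' x - \<phi>' y\<bar> \<le> L * \<bar>x - y\<bar>" using lipschitz_onD[OF lip, of x y] by (simp add: dist_real_def)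
      also have "\<dots> \<le> L * dist p q" using x L by (rule mult_left_mono)
      finally show "\<bar>\<phi>' x - \<phi>' y\<bar> \<le> L * dist p q" .
    qed (rule v)
    finally show "dist (G p) (G q) \<le> K * dist p q" by (simp add: K_def algebra_simps)
  qed (use L \<mu> in \<open>simp add: K_def\<close>)
  then obtain y where y0: "y 0 = (x0, v0)"
    and y: "\<And>t. 0 \<le> t \<Longrightarrow> (y has_vector_derivative G (y t)) (at t within {0..})"
    using lipschitz_ode_solution[of K G "(x0, v0)"] by blast
  define X V where "X t = vec 1 (\<lambda>_. fst (y t))" and "V t = vec 1 (\<lambda>_. snd (y t))" for t
  have der: "((\<lambda>s. fst (y s)) has_real_derivative snd (y t)) (at t within {0..})"
    "((\<lambda>s. snd (y s)) has_real_derivative - (2 * sqrt \<mu>) * snd (y t) - \<phi>' (fst (y t))) (at t within {0..})"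
    if "0 \<le> t" for t
    using has_derivative_fst[OF y[OF that, unfolded has_vector_derivative_def]]
      has_derivative_snd[OF y[OF that, unfolded has_vector_derivative_def]]
    by (simp_all add: has_field_derivative_def G_def case_prod_beta mult_commute_abs)
  have grad: "gradient 1 (\<lambda>z. \<phi> (z $ 0)) (X t) = vec 1 (\<lambda>_. \<phi>' (fst (y t)))" for t
    using gradient_eq[OF _ has_gradient_vec1[OF deriv], of "X t"] by (simp add: X_def)
  have "polyak_trajectory 1 \<mu> (\<lambda>z. \<phi> (z $ 0)) X V"
    unfolding polyak_trajectory_def
  proof (intro allI impI conjI bexI)
    fix t :: real assume t: "0 \<le> t"
    let ?A = "vec 1 (\<lambda>_. - (2 * sqrt \<mu>) * snd (y t) - \<phi>' (fst (y t)))"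
    show "X t \<in> carrier_vec 1" "V t \<in> carrier_vec 1" "?A \<in> carrier_vec 1" by (simp_all add: X_def V_def)
    show "has_vec_deriv 1 X (V t) (at t within {0..})" "has_vec_deriv 1 V ?A (at t within {0..})"
      using der[OF t] by (simp_all add: has_vec_deriv_def X_def V_def)
    show "?A + (2 * sqrt \<mu>) \<cdot>\<^sub>v V t + gradient 1 (\<lambda>z. \<phi> (z $ 0)) (X t) = 0\<^sub>v 1"
      unfolding grad by (intro eq_vecI) (auto simp: V_def)
  qed
  moreover have "X 0 $ 0 = x0" "V 0 $ 0 = v0" by (simp_all add: X_def V_def y0)
  ultimately show ?thesis by (rule that)
qed

text \<open>Assertion (i) of the equivalence, named so that the necessity lemmas can assume
  it.\<close>

definition polyak_lyapunov_decay :: "real \<Rightarrow> real \<Rightarrow> real \<Rightarrow> real mat \<Rightarrow> bool" where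
  "polyak_lyapunov_decay \<mu> \<tau> a P \<longleftrightarrow>
    (\<forall>d f xstar X V.
        f \<in> strongly_convex_class d \<mu> \<longrightarrow>
        is_arg_min f (\<lambda>x. x \<in> carrier_vec d) xstar \<longrightarrow>
        polyak_trajectory d \<mu> f X V \<longrightarrow>
          lyapunov_along (\<lambda>t. lyapunov_fun d a P f xstar (X t) (V t)) \<and>
          (\<forall>t\<ge>0. \<exists>D.
             ((\<lambda>s. lyapunov_fun d a P f xstar (X s) (V s)) has_real_derivative D) (at t within {0..}) \<and>
             D \<le> - \<tau> * lyapunov_fun d a P f xstar (X t) (V t)))"

text \<open>Start a one-dimensional trajectory at position x and velocity v and read nonnegativity
  and decay at time 0. Since every initial state is admissible, the statement about trajectories
  becomes a pointwise inequality in x and v.\<close>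

lemma lyapunov_decay_vec1:
  assumes P: "P = mat_of_rows_list 2 [[p11, p12], [p12, p22]]" and \<mu>: "0 < \<mu>"
    and lyap: "polyak_lyapunov_decay \<mu> \<tau> a P"
    and deriv: "\<And>y. (\<phi> has_real_derivative \<phi>' y) (at y)" and lip: "L-lipschitz_on UNIV \<phi>'"
    and conv: "\<And>x y. \<phi> x \<ge> \<phi> y + \<phi>' y * (x - y) + \<mu> / 2 * (x - y)\<^sup>2" and crit: "\<phi>' 0 = 0"
  defines "E \<equiv> \<lambda>x v. a * (\<phi> x - \<phi> 0) + (p11 * x\<^sup>2 + 2 * p12 * (x * v) + p22 * v\<^sup>2)"
  shows "0 \<le> E x v"
    and "a * (v * \<phi>' x) + 2 * p11 * (x * v) + 2 * p12 * (v\<^sup>2 - 2 * sqrt \<mu> * (x * v) - x * \<phi>' x) +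
      2 * p22 * (- 2 * sqrt \<mu> * v\<^sup>2 - v * \<phi>' x) \<le> - \<tau> * E x v"
proof -
  define f where "f = (\<lambda>z :: real vec. \<phi> (z $ 0))"
  obtain X V where traj: "polyak_trajectory 1 \<mu> f X V" and init: "X 0 $ 0 = x" "V 0 $ 0 = v"
    unfolding f_def using polyak_trajectory_vec1_exists[OF deriv lip less_imp_le[OF \<mu>]] .
  have f: "f \<in> strongly_convex_class 1 \<mu>"
    unfolding f_def by (rule strongly_convex_class_vec1[OF deriv conv])
  have "\<phi> 0 \<le> \<phi> y" for y
  proof -
    have "0 \<le> \<mu> / 2 * y\<^sup>2" using \<mu> by simp
    then show ?thesis using conv[of 0 y] crit by simp
  qed
  then have min: "is_arg_min f (\<lambda>x. x \<in> carrier_vec 1) (0\<^sub>v 1)"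
    by (simp add: is_arg_min_def f_def not_less)
  have c: "X 0 \<in> carrier_vec 1" "V 0 \<in> carrier_vec 1" using traj by (auto simp: polyak_trajectory_def)
  have grad: "gradient 1 f (X 0) = vec 1 (\<lambda>_. \<phi>' x)"
    unfolding f_def using gradient_eq[OF c(1) has_gradient_vec1[OF deriv c(1)]] by (simp add: init)
  let ?L = "\<lambda>t. lyapunov_fun 1 a P f (0\<^sub>v 1) (X t) (V t)"
  have L0: "?L 0 = E x v"
    using c by (simp add: lyapunov_fun_eq[OF P] scalar_prod_sum[where d = 1] E_def f_def init
        power2_eq_square)
  note decay = lyap[unfolded polyak_lyapunov_decay_def, rule_format, OF f min traj]
  show "0 \<le> E x v"
    using decay unfolding lyapunov_along_def L0[symmetric] by blast
  obtain D where D: "(?L has_real_derivative D) (at 0 within {0..})" "D \<le> - \<tau> * ?L 0"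
    using decay by blast
  \<comment> \<open>One-sided derivatives at 0 are unique, so the D supplied by the hypothesis is
    the derivative computed from the differential equation.\<close>
  have "at (0 :: real) within {0..} \<noteq> bot"
    by (simp add: at_within_Ici_at_right)
  from has_field_derivative_unique[OF D(1) lyapunov_fun_has_real_derivative[OF P f _ traj] this]
  have "D = a * (V 0 \<bullet> vec 1 (\<lambda>_. \<phi>' x)) + 2 * p11 * (X 0 \<bullet> V 0) +
      2 * p12 * (V 0 \<bullet> V 0 - 2 * sqrt \<mu> * (X 0 \<bullet> V 0) - X 0 \<bullet> vec 1 (\<lambda>_. \<phi>' x)) +
      2 * p22 * (- 2 * sqrt \<mu> * (V 0 \<bullet> V 0) - V 0 \<bullet> vec 1 (\<lambda>_. \<phi>' x))"
    using c unfolding grad by simp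
  then show "a * (v * \<phi>' x) + 2 * p11 * (x * v) + 2 * p12 * (v\<^sup>2 - 2 * sqrt \<mu> * (x * v) - x * \<phi>' x) +
      2 * p22 * (- 2 * sqrt \<mu> * v\<^sup>2 - v * \<phi>' x) \<le> - \<tau> * E x v"
    using D(2) c unfolding L0 by (simp add: scalar_prod_sum[where d = 1] init power2_eq_square)
qed

subsection \<open>Smoothed kinks\<close>

text \<open>Reading the smoothed kink as a norm in the plane makes Cauchy-Schwarz and the reverse
  triangle inequality available.\<close>

lemma sqrt_power2_add_eq_norm: "sqrt (x\<^sup>2 + e\<^sup>2) = norm (x :: real, e :: real)"
  by (simp add: norm_Pair)

text \<open>Multiplied by the positive root at y, the tangent bound is Cauchy-Schwarz for the plane
  vectors (x, e) and (y, e).\<close>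

lemma sqrt_power2_add_tangent:
  assumes "0 < e"
  shows "sqrt (x\<^sup>2 + e\<^sup>2) \<ge> sqrt (y\<^sup>2 + e\<^sup>2) + y / sqrt (y\<^sup>2 + e\<^sup>2) * (x - y)"
proof -
  define s where "s = sqrt (y\<^sup>2 + e\<^sup>2)"
  have s: "0 < s" "s * s = y\<^sup>2 + e\<^sup>2" using assms by (simp_all add: s_def add_nonneg_pos)
  have "x * y + e * e \<le> sqrt (x\<^sup>2 + e\<^sup>2) * s"
    using norm_cauchy_schwarz[of "(x, e)" "(y, e)"]
    by (simp add: s_def sqrt_power2_add_eq_norm inner_Pair)
  then have "s * s + y * (x - y) \<le> sqrt (x\<^sup>2 + e\<^sup>2) * s"
    unfolding s(2) by (simp add: algebra_simps power2_eq_square)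
  then have "(s * s + y * (x - y)) / s \<le> sqrt (x\<^sup>2 + e\<^sup>2)" using s(1) by (simp only: pos_divide_le_eq)
  then show ?thesis using s(1) unfolding s_def[symmetric] by (simp add: add_divide_distrib)
qed

lemma lipschitz_divide_sqrt_power2_add:
  assumes e: "0 < e"
  shows "(2 / e)-lipschitz_on UNIV (\<lambda>y :: real. y / sqrt (y\<^sup>2 + e\<^sup>2))"
proof (rule lipschitz_onI)
  fix x y :: real
  define s where "s z = sqrt (z\<^sup>2 + e\<^sup>2)" for z :: real
  have es: "e \<le> s z" and s: "0 < s z" and zs: "\<bar>z\<bar> \<le> s z" for z
  proof -
    show "e \<le> s z" unfolding s_def by (rule real_le_rsqrt) simp
    then show "0 < s z" using e by linarith
    show "\<bar>z\<bar> \<le> s z" unfolding s_def by (rule real_le_rsqrt) simp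
  qed
  have "norm ((y, e) - (x, e)) = \<bar>x - y\<bar>" by (simp add: norm_Pair abs_minus_commute)
  then have diff: "\<bar>s y - s x\<bar> \<le> \<bar>x - y\<bar>"
    unfolding s_def sqrt_power2_add_eq_norm using norm_triangle_ineq3[of "(y, e)" "(x, e)"] by simp
  \<comment> \<open>Changes of numerator and denominator are separated; as s is 1-Lipschitz and at
    least e, each part is at most |x - y| / e.\<close>
  have "x / s x - y / s y = (x - y) / s x + y / s y * ((s y - s x) / s x)"
    using s[of x] s[of y] by (simp add: field_simps)
  then have "\<bar>x / s x - y / s y\<bar> \<le> \<bar>x - y\<bar> / s x + \<bar>y\<bar> / s y * (\<bar>s y - s x\<bar> / s x)"
    using s[of x] s[of y] abs_triangle_ineq[of "(x - y) / s x" "y / s y * ((s y - s x) / s x)"]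
    by (simp add: abs_mult)
  also have "\<dots> \<le> \<bar>x - y\<bar> / e + 1 * (\<bar>x - y\<bar> / e)"
    using s[of x] s[of y] es[of x] zs[of y] diff e
    by (intro add_mono mult_mono frac_le) (auto simp: divide_le_eq_1)
  finally show "dist (x / sqrt (x\<^sup>2 + e\<^sup>2)) (y / sqrt (y\<^sup>2 + e\<^sup>2)) \<le> 2 / e * dist x y"
    by (simp add: dist_real_def s_def)
qed (use e in simp)

text \<open>For b > 0 the choice c = (|K| + 1) / b would give the positive value K + |K| + 1.
  Applied to kinks of arbitrary strength c, this isolates the terms of the decay inequality that are
  linear in c.\<close>

lemma slope_nonpos_if_bounded_above:
  fixes K b :: real
  assumes "\<And>c. 0 \<le> c \<Longrightarrow> K + c * b \<le> 0"
  shows "b \<le> 0"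
proof (rule ccontr)
  assume b: "\<not> b \<le> 0"
  then have "(\<bar>K\<bar> + 1) / b * b = \<bar>K\<bar> + 1" by simp
  then show False using assms[of "(\<bar>K\<bar> + 1) / b"] b by (simp add: divide_nonneg_pos)
qed

text \<open>
  The smoothed kinks \<open>\<phi> y = \<mu>/2 y\<^sup>2 + c sqrt (y\<^sup>2 + e\<^sup>2)\<close> nearly saturate the interpolation inequality
  \<open>\<phi> x - \<phi> 0 \<le> x \<phi>' x - \<mu>/2 x\<^sup>2\<close> at \<open>x = 1\<close> as \<open>e\<close> tends to 0, with a gradient that grows with \<open>c\<close>.
\<close>

lemma multipliers_if_lyapunov_decay:
  assumes P: "P = mat_of_rows_list 2 [[p11, p12], [p12, p22]]"
    and \<mu>: "0 < \<mu>" and \<tau>: "0 \<le> \<tau>" and a: "0 \<le> a"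
    and lyap: "polyak_lyapunov_decay \<mu> \<tau> a P"
  shows "a = 2 * p22" and "\<tau> * a \<le> 2 * p12"
    and "0 \<le> (p11 + \<mu> / 2 * a) * x\<^sup>2 + p22 * y\<^sup>2 + 2 * (p12 * x * y)"
    and "(- (\<mu> / 2) * (2 * p12 + (2 * p12 - \<tau> * a)) + \<tau> * p11) * x\<^sup>2 + (2 * (p12 - 2 * sqrt \<mu> * p22) + \<tau> * p22) * y\<^sup>2 +
      2 * ((p11 - 2 * sqrt \<mu> * p12 + \<tau> * p12) * x * y) \<le> 0"
proof -
  define S where "S e y = sqrt (y\<^sup>2 + e\<^sup>2)" for e y :: real
  define \<phi> where "\<phi> c e y = \<mu> / 2 * y\<^sup>2 + c * S e y" for c e y
  define \<phi>' where "\<phi>' c e y = \<mu> * y + c * (y / S e y)" for c e y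
  have deriv: "(\<phi> c e has_real_derivative \<phi>' c e y) (at y)" if "0 < e" for c e y
  proof -
    have "0 < y\<^sup>2 + e\<^sup>2" using that by (simp add: add_nonneg_pos)
    then show ?thesis unfolding \<phi>_def \<phi>'_def S_def
      by (auto intro!: derivative_eq_intros simp: field_simps)
  qed
  have conv: "\<phi> c e x \<ge> \<phi> c e y + \<phi>' c e y * (x - y) + \<mu> / 2 * (x - y)\<^sup>2" if "0 < e" "0 \<le> c" for c e x y
  proof -
    have "c * S e x \<ge> c * (S e y + y / S e y * (x - y))"
      unfolding S_def using sqrt_power2_add_tangent[OF that(1)] that(2) by (rule mult_left_mono)
    moreover have "\<mu> / 2 * x\<^sup>2 = \<mu> / 2 * y\<^sup>2 + \<mu> * y * (x - y) + \<mu> / 2 * (x - y)\<^sup>2"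
      by (simp add: field_simps power2_eq_square)
    ultimately show ?thesis unfolding \<phi>_def \<phi>'_def by (simp only: distrib_left distrib_right)
  qed
  have lip: "(\<bar>\<mu>\<bar> * 1 + \<bar>c\<bar> * (2 / e))-lipschitz_on UNIV (\<phi>' c e)" if "0 < e" for c e
  proof -
    have "(\<bar>\<mu>\<bar> * 1)-lipschitz_on UNIV (\<lambda>y. \<mu> * y)"
      using lipschitz_on_cmult_real[OF lipschitz_on_id] .
    moreover have "(\<bar>c\<bar> * (2 / e))-lipschitz_on UNIV (\<lambda>y. c * (y / S e y))"
      unfolding S_def by (rule lipschitz_on_cmult_real[OF lipschitz_divide_sqrt_power2_add[OF that]])
    ultimately show ?thesis unfolding \<phi>'_def by (rule lipschitz_on_add)
  qed
  have crit: "\<phi>' c e 0 = 0" for c e by (simp add: \<phi>'_def)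
  note test = lyapunov_decay_vec1[OF P \<mu> lyap deriv lip conv crit]
  \<comment> \<open>For the kink of strength c, the decay inequality at position 1 and velocity v is
    affine in c, with slope \<open>\<beta> e v\<close>.\<close>
  define \<beta> where "\<beta> e v = (a * v - 2 * p12 - 2 * p22 * v) / S e 1 + \<tau> * a * (S e 1 - e)" for e v
  have beta: "\<beta> e v \<le> 0" if e: "0 < e" for e v
  proof (rule slope_nonpos_if_bounded_above)
    fix c :: real assume c: "0 \<le> c"
    have vals: "\<phi> c e 1 - \<phi> c e 0 = \<mu> / 2 + c * (S e 1 - e)" "\<phi>' c e 1 = \<mu> + c / S e 1"
      using e by (simp_all add: \<phi>_def \<phi>'_def S_def algebra_simps)
    have eq: "a * (v * (\<mu> + c / S e 1)) + 2 * p11 * (1 * v) + 2 * p12 * (v\<^sup>2 - 2 * sqrt \<mu> * (1 * v) - 1 * (\<mu> + c / S e 1)) +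
        2 * p22 * (- 2 * sqrt \<mu> * v\<^sup>2 - v * (\<mu> + c / S e 1)) +
        \<tau> * (a * (\<mu> / 2 + c * (S e 1 - e)) + (p11 * 1\<^sup>2 + 2 * p12 * (1 * v) + p22 * v\<^sup>2)) =
      (a * v * \<mu> + 2 * p11 * v + 2 * p12 * (v\<^sup>2 - 2 * sqrt \<mu> * v - \<mu>) + 2 * p22 * (- 2 * sqrt \<mu> * v\<^sup>2 - v * \<mu>) +
        \<tau> * (a * (\<mu> / 2) + (p11 + 2 * p12 * v + p22 * v\<^sup>2))) + c * \<beta> e v"
      unfolding \<beta>_def by (simp add: algebra_simps diff_divide_distrib add_divide_distrib)
    show "(a * v * \<mu> + 2 * p11 * v + 2 * p12 * (v\<^sup>2 - 2 * sqrt \<mu> * v - \<mu>) + 2 * p22 * (- 2 * sqrt \<mu> * v\<^sup>2 - v * \<mu>) +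
        \<tau> * (a * (\<mu> / 2) + (p11 + 2 * p12 * v + p22 * v\<^sup>2))) + c * \<beta> e v \<le> 0"
      using test(2)[OF e e e c, of v 1] unfolding vals eq[symmetric] by linarith
  qed
  have S: "0 < S e 1" if "0 < e" for e using that by (simp add: S_def add_pos_nonneg)
  show a2: "a = 2 * p22"
  proof (rule ccontr)
    assume "a \<noteq> 2 * p22"
    \<comment> \<open>At e = 1 the slope condition reads \<open>(a - 2 * p22) * v \<le> M\<close>
      with M independent of v. If the coefficient were nonzero, a suitable velocity would make the
      left side equal to M + 1.\<close>
    define M where "M = 2 * p12 - \<tau> * a * (S 1 1 - 1) * S 1 1"
    define v where "v = (M + 1) / (a - 2 * p22)"
    have "(a - 2 * p22) * v = M + 1" using \<open>a \<noteq> 2 * p22\<close> by (simp add: v_def)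
    moreover have "(a - 2 * p22) * v \<le> M"
      using beta[of 1 v] S[of 1] by (simp add: \<beta>_def M_def field_simps)
    ultimately show False by simp
  qed
  show "\<tau> * a \<le> 2 * p12"
  proof (rule field_le_epsilon)
    fix \<delta> :: real assume \<delta>: "0 < \<delta>"
    \<comment> \<open>At velocity 0 the slope condition bounds
      \<open>\<tau> * a * ((S e 1 - e) * S e 1)\<close> by \<open>2 * p12\<close>, and the inner
      product of factors is at least 1 - e. This e makes the loss \<tau> a e at most \<delta>; the
      summand 1 keeps the denominator positive.\<close>
    define e where "e = \<delta> / (\<tau> * a + 1)"
    have ta: "0 \<le> \<tau> * a" using \<tau> a by simp
    then have e: "0 < e" using \<delta> by (simp add: e_def)
    have "\<tau> * a * e \<le> (\<tau> * a + 1) * e" using e by (intro mult_right_mono) auto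
    also have "\<dots> = \<delta>" using ta by (simp add: e_def)
    finally have small: "\<tau> * a * e \<le> \<delta>" .
    have "S e 1 \<le> 1 + e" unfolding S_def using e by (intro real_le_lsqrt) (auto simp: power2_eq_square algebra_simps)
    then have "e * S e 1 \<le> e * (1 + e)" using e by (intro mult_left_mono) auto
    moreover have "S e 1 * S e 1 = 1 + e * e" by (simp add: S_def power2_eq_square)
    ultimately have "1 - e \<le> (S e 1 - e) * S e 1" by (simp add: algebra_simps)
    then have "\<tau> * a * (1 - e) \<le> \<tau> * a * ((S e 1 - e) * S e 1)" using ta by (rule mult_left_mono)
    also have "\<dots> \<le> 2 * p12" using beta[OF e, of 0] S[OF e] by (simp add: \<beta>_def field_simps)
    finally show "\<tau> * a \<le> 2 * p12 + \<delta>" using small by (simp add: algebra_simps)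
  qed
  \<comment> \<open>With c = 0 the kink disappears and the test function is the pure quadratic, for
    any positive e. Its gradient \<mu> x turns both conditions into quadratic forms in position and
    velocity; in the decay form, a = 2 p22 cancels the products of velocity and gradient.\<close>
  have one: "(0 :: real) < 1" by simp
  have quad: "\<phi> 0 1 x - \<phi> 0 1 0 = \<mu> / 2 * x\<^sup>2" "\<phi>' 0 1 x = \<mu> * x" by (simp_all add: \<phi>_def \<phi>'_def)
  show "0 \<le> (p11 + \<mu> / 2 * a) * x\<^sup>2 + p22 * y\<^sup>2 + 2 * (p12 * x * y)"
    using test(1)[OF one one one order_refl, of x y] unfolding quad by (simp add: algebra_simps)
  show "(- (\<mu> / 2) * (2 * p12 + (2 * p12 - \<tau> * a)) + \<tau> * p11) * x\<^sup>2 + (2 * (p12 - 2 * sqrt \<mu> * p22) + \<tau> * p22) * y\<^sup>2 +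
      2 * ((p11 - 2 * sqrt \<mu> * p12 + \<tau> * p12) * x * y) \<le> 0"
    using test(2)[OF one one one order_refl, of y x] unfolding quad
    by (simp add: a2 algebra_simps power2_eq_square)
qed

section \<open>Equivalence of universal decay and the two matrix inequalities\<close>

theorem theorem2p5:
  fixes \<mu> \<tau> a p11 p12 p22 :: real and P :: "real mat"
  assumes "\<mu> > 0" and "\<tau> \<ge> 0" and "a \<ge> 0"
    and "P = mat_of_rows_list 2 [[p11, p12], [p12, p22]]"
  shows
    "(\<forall>d f xstar X V.
        f \<in> strongly_convex_class d \<mu> \<longrightarrow>
        is_arg_min f (\<lambda>x. x \<in> carrier_vec d) xstar \<longrightarrow>
        polyak_trajectory d \<mu> f X V \<longrightarrow>
          lyapunov_along (\<lambda>t. lyapunov_fun d a P f xstar (X t) (V t)) \<and>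
          (\<forall>t\<ge>0. \<exists>D.
             ((\<lambda>s. lyapunov_fun d a P f xstar (X s) (V s)) has_real_derivative D) (at t within {0..}) \<and>
             D \<le> - \<tau> * lyapunov_fun d a P f xstar (X t) (V t)))
     \<longleftrightarrow>
     (\<exists>l1 l2 n1 n2 :: real.
        l1 \<ge> 0 \<and> l2 \<ge> 0 \<and> n1 \<ge> 0 \<and> n2 \<ge> 0 \<and>
        nsd (mat_of_rows_list 3
          [[- (\<mu> / 2) * (l1 + l2) + \<tau> * p11, p11 - 2 * sqrt \<mu> * p12 + \<tau> * p12, - p12 + l1 / 2],
           [p11 - 2 * sqrt \<mu> * p12 + \<tau> * p12, 2 * (p12 - 2 * sqrt \<mu> * p22) + \<tau> * p22, - p22 + a / 2],
           [- p12 + l1 / 2, - p22 + a / 2, 0]]) \<and>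
        \<tau> * a = l1 - l2 \<and>
        psd (four_block_mat P (0\<^sub>m 2 1) (0\<^sub>m 1 2) (0\<^sub>m 1 1) +
          mat_of_rows_list 3
          [[\<mu> / 2 * (n1 + n2), 0, - (n1 / 2)],
           [0, 0, 0],
           [- (n1 / 2), 0, 0]]) \<and>
        a = n2 - n1)"
    (is "?lyapunov \<longleftrightarrow> ?multipliers")
proof
  assume ?lyapunov
  then have "polyak_lyapunov_decay \<mu> \<tau> a P" unfolding polyak_lyapunov_decay_def .
  note nec = multipliers_if_lyapunov_decay[OF assms(4,1,2,3) this]
  have a: "\<tau> * a \<le> 2 * p12" "0 \<le> \<tau> * a" using nec(2) assms by auto
  \<comment> \<open>The witnesses are l1 = 2 p12, l2 = 2 p12 - \<tau> a, n1 = 0 and n2 = a. With a =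
    2 p22 they make the third row and column of both matrices vanish, which leaves the two-variable
    forms already established.\<close>
  show ?multipliers
  proof (intro exI conjI)
    show "0 \<le> 2 * p12" "0 \<le> 2 * p12 - \<tau> * a" "0 \<le> (0 :: real)" "0 \<le> a"
      "\<tau> * a = 2 * p12 - (2 * p12 - \<tau> * a)" "a = a - 0"
      using a assms(3) by linarith+
    show "nsd (mat_of_rows_list 3
          [[- (\<mu> / 2) * ((2 * p12) + (2 * p12 - \<tau> * a)) + \<tau> * p11, p11 - 2 * sqrt \<mu> * p12 + \<tau> * p12, - p12 + (2 * p12) / 2],
           [p11 - 2 * sqrt \<mu> * p12 + \<tau> * p12, 2 * (p12 - 2 * sqrt \<mu> * p22) + \<tau> * p22, - p22 + a / 2],
           [- p12 + (2 * p12) / 2, - p22 + a / 2, 0]])"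
      unfolding nsd_mat3_iff using nec(4) nec(1) by simp
    show "psd (four_block_mat P (0\<^sub>m 2 1) (0\<^sub>m 1 2) (0\<^sub>m 1 1) +
          mat_of_rows_list 3
          [[\<mu> / 2 * ((0 :: real) + a), 0, - ((0 :: real) / 2)],
           [0, 0, 0],
           [- ((0 :: real) / 2), 0, 0]])"
      unfolding assms(4) block_mat3 psd_mat3_iff using nec(3) by simp
  qed
next
  assume ?multipliers
  then obtain l1 l2 n1 n2 where
    signs: "0 \<le> l1" "0 \<le> l2" "0 \<le> n1" "0 \<le> n2" and eqs: "\<tau> * a = l1 - l2" "a = n2 - n1"
    and decay: "nsd (mat_of_rows_list 3
          [[- (\<mu> / 2) * (l1 + l2) + \<tau> * p11, p11 - 2 * sqrt \<mu> * p12 + \<tau> * p12, - p12 + l1 / 2],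
           [p11 - 2 * sqrt \<mu> * p12 + \<tau> * p12, 2 * (p12 - 2 * sqrt \<mu> * p22) + \<tau> * p22, - p22 + a / 2],
           [- p12 + l1 / 2, - p22 + a / 2, 0]])"
    and nonneg: "psd (four_block_mat P (0\<^sub>m 2 1) (0\<^sub>m 1 2) (0\<^sub>m 1 1) +
          mat_of_rows_list 3
          [[\<mu> / 2 * (n1 + n2), 0, - (n1 / 2)],
           [0, 0, 0],
           [- (n1 / 2), 0, 0]])"
    by blast
  show ?lyapunov
  proof (intro allI impI)
    fix d f xstar X V
    assume traj: "f \<in> strongly_convex_class d \<mu>" "is_arg_min f (\<lambda>x. x \<in> carrier_vec d) xstar"
      "polyak_trajectory d \<mu> f X V"
    show "lyapunov_along (\<lambda>t. lyapunov_fun d a P f xstar (X t) (V t)) \<and>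
        (\<forall>t\<ge>0. \<exists>D.
          ((\<lambda>s. lyapunov_fun d a P f xstar (X s) (V s)) has_real_derivative D) (at t within {0..}) \<and>
          D \<le> - \<tau> * lyapunov_fun d a P f xstar (X t) (V t))"
      using lyapunov_decay_if_multipliers[OF assms(4,2) signs eqs decay[unfolded nsd_mat3_iff]
          nonneg[unfolded assms(4) block_mat3 psd_mat3_iff] traj] .
  qed
qed

end
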